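(* Let $\mathcal{A}=\{1,\dots,N\}$, $\mathcal{C}=\{1,\dots,K\}$. Let each agent $i\in\mathcal{A}$ obey $$\dot x_i=-\alpha_i\nabla f_i(x_i)+\alpha_iu_i,\qquad y_i=x_i,$$ with $\alpha_i>0$, and each controller $k\in\mathcal{C}$ obey $$\dot z_k=\beta_k\zeta_k,\qquad d_k=z_k+\beta_k\zeta_k,$$ with $\beta_k>0$, where $x_i,u_i,y_i,z_k,\zeta_k,d_k\in\mathbb{R}^n$. Let them be interconnected by $\zeta=(E\otimes I_n)^\top y$, $u=-(E\otimes I_n)d$, where $E\in\mathbb{R}^{N\times K}$ fulfills $\ker(E^\top)=\{\alpha1_N\mid\alpha\in\mathbb{R}\}$. If the objective functions $f_i:\mathbb{R}^n\to\mathbb{R}$ are convex and the sum $\sum_{i\in\mathcal{A}}f_i$ is strictly convex, then all trajectories converge to an equilibrium point in the invariant manifold $$\mathcal{M}_{\mathrm{eq}}=\{(\bar y,\bar d)\in\mathbb{R}^{Nn}\times\mathbb{R}^{Kn}\mid\bar y=1_N\otimes\mathrm{y}^*\},$$ where $\mathrm{y}^*$ is the minimizer of $\sum_{i\in\mathcal{A}}f_i$.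
   Context: Standing assumptions: the $f_i$ are differentiable and the unconstrained problem $\min_{\mathrm{y}\in\mathbb{R}^n}\sum_{i\in\mathcal{A}}f_i(\mathrm{y})$ has a minimizer $\mathrm{y}^*$ (unique by strict convexity). Stacked variables: $y=\mathrm{col}(y_i)$, $u=\mathrm{col}(u_i)$, $\zeta=\mathrm{col}(\zeta_k)$, $d=\mathrm{col}(d_k)$. $1_N$ is the all-ones vector. $E$ is the communication matrix (the incidence matrix of the undirected communication graph, or more generally any real matrix with the stated kernel property).
   Formalization: The manifold M_eq as printed leaves d̄ free and is not invariant in general; invariance is stated instead for the set of equilibrium points in M_eq, while convergence of all trajectories to an equilibrium point in M_eq is stated as in the text. *)

theory Defs
  imports "HOL-Analysis.Analysis"
begin

text \<open>
  Agents and controllers are indexed by the finite types \<open>'a\<close> and \<open>'k\<close>, the components of the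
  local variables by the finite type \<open>'n\<close>.  A stacked vector with blocks in \<open>real ^ 'n\<close> is
  indexed by pairs (block, component).
\<close>

definition col :: "('i::finite \<Rightarrow> real ^ 'n) \<Rightarrow> real ^ ('i \<times> 'n::finite)"
  where "col v = (\<chi> p. v (fst p) $ snd p)"

definition kron :: "real ^ 'c ^ 'r \<Rightarrow> real ^ 'd ^ 's \<Rightarrow>
    real ^ ('c::finite \<times> 'd::finite) ^ ('r::finite \<times> 's::finite)"
  where "kron A B = (\<chi> p q. A $ fst p $ fst q * B $ snd p $ snd q)"

definition kron_vec :: "real ^ 'r \<Rightarrow> real ^ 's \<Rightarrow> real ^ ('r::finite \<times> 's::finite)"
  where "kron_vec v w = (\<chi> p. v $ fst p * w $ snd p)"

definition gradient :: "('v::real_inner \<Rightarrow> real) \<Rightarrow> 'v \<Rightarrow> 'v"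
  where "gradient g p = (THE D. GDERIV g p :> D)"

definition strictly_convex :: "('v::real_vector \<Rightarrow> real) \<Rightarrow> bool"
  where "strictly_convex g \<longleftrightarrow>
    (\<forall>p q t. p \<noteq> q \<longrightarrow> 0 < t \<longrightarrow> t < 1 \<longrightarrow>
       g ((1 - t) *\<^sub>R p + t *\<^sub>R q) < (1 - t) * g p + t * g q)"

definition matrix_kernel :: "real ^ 'c ^ 'r \<Rightarrow> (real ^ 'c::finite) set"
  where "matrix_kernel A = {v. A *v v = 0}"

definition agent_field :: "('v::real_inner \<Rightarrow> real) \<Rightarrow> real \<Rightarrow> 'v \<Rightarrow> 'v \<Rightarrow> 'v"
  where "agent_field g a x u = - a *\<^sub>R gradient g x + a *\<^sub>R u"

definition agent_output :: "'v \<Rightarrow> 'v"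
  where "agent_output x = x"

definition controller_field :: "real \<Rightarrow> 'v::real_vector \<Rightarrow> 'v"
  where "controller_field b \<zeta> = b *\<^sub>R \<zeta>"

definition controller_output :: "real \<Rightarrow> 'v::real_vector \<Rightarrow> 'v \<Rightarrow> 'v"
  where "controller_output b z \<zeta> = z + b *\<^sub>R \<zeta>"

definition interconnected :: "real ^ 'k ^ 'a \<Rightarrow>
    ('a::finite \<Rightarrow> real ^ 'n::finite) \<Rightarrow> ('a \<Rightarrow> real ^ 'n) \<Rightarrow>
    ('k::finite \<Rightarrow> real ^ 'n) \<Rightarrow> ('k \<Rightarrow> real ^ 'n) \<Rightarrow> bool"
  where "interconnected E u y \<zeta> d \<longleftrightarrow>
    col \<zeta> = transpose (kron E (mat 1 :: real ^ 'n ^ 'n)) *v col y \<and>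
    col u = - (kron E (mat 1 :: real ^ 'n ^ 'n) *v col d)"

text \<open>
  Trajectories are solutions on the time interval \<open>[0, \<infinity>)\<close> (one-sided derivative at time 0)
  with an arbitrary initial value; nothing is required of the signals at negative times.
\<close>

definition trajectory ::
  "('a::finite \<Rightarrow> real ^ 'n::finite \<Rightarrow> real) \<Rightarrow> ('a \<Rightarrow> real) \<Rightarrow> ('k::finite \<Rightarrow> real) \<Rightarrow> real ^ 'k ^ 'a \<Rightarrow>
   ('a \<Rightarrow> real \<Rightarrow> real ^ 'n) \<Rightarrow> ('a \<Rightarrow> real \<Rightarrow> real ^ 'n) \<Rightarrow> ('a \<Rightarrow> real \<Rightarrow> real ^ 'n) \<Rightarrow>
   ('k \<Rightarrow> real \<Rightarrow> real ^ 'n) \<Rightarrow> ('k \<Rightarrow> real \<Rightarrow> real ^ 'n) \<Rightarrow> ('k \<Rightarrow> real \<Rightarrow> real ^ 'n) \<Rightarrow> bool"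
  where "trajectory f \<alpha> \<beta> E x u y z \<zeta> d \<longleftrightarrow>
    (\<forall>t\<ge>0.
      (\<forall>i. (x i has_vector_derivative agent_field (f i) (\<alpha> i) (x i t) (u i t)) (at t within {0..}) \<and>
           y i t = agent_output (x i t)) \<and>
      (\<forall>k. (z k has_vector_derivative controller_field (\<beta> k) (\<zeta> k t)) (at t within {0..}) \<and>
           d k t = controller_output (\<beta> k) (z k t) (\<zeta> k t)) \<and>
      interconnected E (\<lambda>i. u i t) (\<lambda>i. y i t) (\<lambda>k. \<zeta> k t) (\<lambda>k. d k t))"

definition equilibrium ::
  "('a::finite \<Rightarrow> real ^ 'n::finite \<Rightarrow> real) \<Rightarrow> ('a \<Rightarrow> real) \<Rightarrow> ('k::finite \<Rightarrow> real) \<Rightarrow> real ^ 'k ^ 'a \<Rightarrow>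
   ('a \<Rightarrow> real ^ 'n) \<Rightarrow> ('a \<Rightarrow> real ^ 'n) \<Rightarrow> ('a \<Rightarrow> real ^ 'n) \<Rightarrow>
   ('k \<Rightarrow> real ^ 'n) \<Rightarrow> ('k \<Rightarrow> real ^ 'n) \<Rightarrow> ('k \<Rightarrow> real ^ 'n) \<Rightarrow> bool"
  where "equilibrium f \<alpha> \<beta> E x u y z \<zeta> d \<longleftrightarrow>
    (\<forall>i. agent_field (f i) (\<alpha> i) (x i) (u i) = 0 \<and> y i = agent_output (x i)) \<and>
    (\<forall>k. controller_field (\<beta> k) (\<zeta> k) = 0 \<and> d k = controller_output (\<beta> k) (z k) (\<zeta> k)) \<and>
    interconnected E u y \<zeta> d"

definition M_eq :: "real ^ 'n \<Rightarrow> ((real ^ ('a::finite \<times> 'n::finite)) \<times> (real ^ ('k::finite \<times> 'n))) set"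
  where "M_eq ystar = {(ybar, dbar). ybar = kron_vec 1 ystar}"

definition equilibrium_outputs ::
  "('a::finite \<Rightarrow> real ^ 'n::finite \<Rightarrow> real) \<Rightarrow> ('a \<Rightarrow> real) \<Rightarrow> ('k::finite \<Rightarrow> real) \<Rightarrow> real ^ 'k ^ 'a \<Rightarrow>
   ((real ^ ('a \<times> 'n)) \<times> (real ^ ('k \<times> 'n))) set"
  where "equilibrium_outputs f \<alpha> \<beta> E =
    {(col y, col d) | y d. \<exists>x u z \<zeta>. equilibrium f \<alpha> \<beta> E x u y z \<zeta> d}"

text \<open>
  Invariance in the output coordinates \<open>(y, d)\<close> is state invariance, since the state is recovered
  from them by \<open>x = y\<close> and \<open>z\<^sub>k = d\<^sub>k - \<beta>\<^sub>k \<zeta>\<^sub>k\<close> with \<open>\<zeta>\<close> a linear image of \<open>y\<close>.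
  The set \<open>M_eq ystar\<close> leaves the second component free and is as such not invariant in general;
  the invariant object is its set of equilibrium points.
\<close>

definition invariant_set ::
  "('a::finite \<Rightarrow> real ^ 'n::finite \<Rightarrow> real) \<Rightarrow> ('a \<Rightarrow> real) \<Rightarrow> ('k::finite \<Rightarrow> real) \<Rightarrow> real ^ 'k ^ 'a \<Rightarrow>
   ((real ^ ('a \<times> 'n)) \<times> (real ^ ('k \<times> 'n))) set \<Rightarrow> bool"
  where "invariant_set f \<alpha> \<beta> E S \<longleftrightarrow>
    (\<forall>x u y z \<zeta> d. trajectory f \<alpha> \<beta> E x u y z \<zeta> d \<longrightarrow>
       (col (\<lambda>i. y i 0), col (\<lambda>k. d k 0)) \<in> S \<longrightarrow>
       (\<forall>t\<ge>0. (col (\<lambda>i. y i t), col (\<lambda>k. d k t)) \<in> S))"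

end

theory Submission
  imports Defs
begin

text \<open>
  For an equilibrium \<open>(x*, z*)\<close> the energy
  \<open>\<Sum>\<^sub>i |x\<^sub>i - x*\<^sub>i|\<^sup>2 / 2\<alpha>\<^sub>i + \<Sum>\<^sub>k |z\<^sub>k - z*\<^sub>k|\<^sup>2 / 2\<beta>\<^sub>k\<close> decreases at the rate
  \<open>\<Sum>\<^sub>i (x\<^sub>i - y*) \<bullet> (\<nabla>f\<^sub>i(x\<^sub>i) - \<nabla>f\<^sub>i(y*)) + \<Sum>\<^sub>k \<beta>\<^sub>k |\<zeta>\<^sub>k|\<^sup>2\<close>, because the coupling terms cancel.
  This rate depends on \<open>x\<close> only, and it vanishes only at consensus on the minimizer.  Barbalat's
  lemma, applied to the energy, gives \<open>x \<rightarrow> x*\<close>; applied to \<open>x\<close> itself, it gives \<open>x' \<rightarrow> 0\<close>, so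
  that every limit point \<open>b\<close> of \<open>z\<close> belongs to an equilibrium.  The energy relative to \<open>(x*, b)\<close>
  is monotone and tends to \<open>0\<close> along a subsequence, hence \<open>z \<rightarrow> b\<close>.
\<close>

subsection \<open>Barbalat's lemma and asymptotics of trajectories\<close>

text \<open>Increments of a convergent \<open>X\<close> over a step of fixed length \<open>h\<close>
  tend to zero. Uniform continuity makes \<open>w\<close> nearly constant over such a step, so the
  increment is about \<open>h\<close> times \<open>w t\<close>, which forces \<open>w t\<close> to
  be small.\<close>

lemma barbalat:
  fixes X :: "real \<Rightarrow> 'x::real_normed_vector"
  assumes deriv: "\<And>t. 0 \<le> t \<Longrightarrow> (X has_vector_derivative w t) (at t within {0..})"
    and uc: "uniformly_continuous_on {0..} w"
    and lim: "(X \<longlongrightarrow> l) at_top"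
  shows "(w \<longlongrightarrow> 0) at_top"
proof (rule tendstoI)
  fix e :: real assume e: "0 < e"
  then obtain r where r: "r > 0"
    and rw: "\<And>s t. \<lbrakk>s \<in> {0..}; t \<in> {0..}; dist s t < r\<rbrakk> \<Longrightarrow> dist (w s) (w t) < e/2"
    using uc unfolding uniformly_continuous_on_def by (meson half_gt_zero)
  define h where "h = r / 2"
  have h: "0 < h" "h < r" using r by (auto simp: h_def)
  have "filterlim (\<lambda>t. t + h) at_top at_top"
    using filterlim_tendsto_add_at_top[OF tendsto_const[of h] filterlim_ident]
        by (simp add: add.commute)
  from filterlim_compose[OF lim this] lim
  have "((\<lambda>t. X (t + h) - X t) \<longlongrightarrow> l - l) at_top" by (intro tendsto_diff)
  then have "\<forall>\<^sub>F t in at_top. dist (X (t + h) - X t) 0 < h * (e/2)"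
    using e h by (intro tendstoD) auto
  then show "\<forall>\<^sub>F t in at_top. dist (w t) 0 < e"
    using eventually_ge_at_top[of 0]
  proof eventually_elim
    case (elim t)
    \<comment> \<open>Mean value inequality for \<open>X\<close> minus its linearization with slope
      \<open>w t\<close>: on the whole step \<open>w\<close> deviates from \<open>w t\<close> by at
      most e/2.\<close>
    have "norm (X (t + h) - X t - (t + h - t) *\<^sub>R w t) \<le> norm (t + h - t) * (e/2)"
    proof (rule vector_differentiable_bound_linearization[where S = "{t..t+h}"])
      show "(X has_vector_derivative w s) (at s within {t..t+h})" if "s \<in> {t..t+h}" for s
        using that elim by (intro has_vector_derivative_within_subset[OF deriv]) auto
      show "norm (w s - w t) \<le> e/2" if "s \<in> {t..t+h}" for s
        using that elim h rw[of s t] by (auto simp: dist_norm)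
    qed (use h in \<open>auto simp: closed_segment_eq_real_ivl\<close>)
    then have "norm (h *\<^sub>R w t - (X (t + h) - X t)) \<le> h * (e/2)"
      using h by (simp add: norm_minus_commute)
    then have "norm (h *\<^sub>R w t) < h * (e/2) + h * (e/2)"
      using elim(1) norm_triangle_sub[of "h *\<^sub>R w t" "X (t + h) - X t"]
          by (simp only: dist_norm diff_zero)
    then have "h * norm (w t) < h * e" using h by (simp add: field_simps)
    then show ?case using h by simp
  qed
qed

lemma decreasing_bounded_below_convergent:
  fixes V :: "real \<Rightarrow> real"
  assumes dec: "\<And>s t. \<lbrakk>0 \<le> s; s \<le> t\<rbrakk> \<Longrightarrow> V t \<le> V s"
    and nonneg: "\<And>t. 0 \<le> t \<Longrightarrow> 0 \<le> V t"
  obtains l where "(V \<longlongrightarrow> l) at_top"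
proof
  have bdd: "bdd_below (V ` {0..})" using nonneg by (auto intro: bdd_belowI[of _ 0])
  have le: "Inf (V ` {0..}) \<le> V t" if "0 \<le> t" for t
    using that bdd by (auto intro: cInf_lower)
  show "(V \<longlongrightarrow> Inf (V ` {0..})) at_top"
  proof (rule decreasing_tendsto)
    show "\<forall>\<^sub>F t in at_top. Inf (V ` {0..}) \<le> V t"
      using eventually_ge_at_top[of 0] by eventually_elim (rule le)
    fix x assume "Inf (V ` {0..}) < x"
    then obtain s where s: "0 \<le> s" "V s < x"
      using bdd by (subst (asm) cInf_less_iff) auto
    show "\<forall>\<^sub>F t in at_top. V t < x"
      using eventually_ge_at_top[of s] by eventually_elim (use s dec in fastforce)
  qed
qed

text \<open>Away from \<open>a\<close>, the closure of the bounded orbit is compact, so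
  \<open>W\<close> has a positive minimum there. Once \<open>W (X t)\<close> falls below it,
  \<open>X t\<close> must be near \<open>a\<close>. This turns a vanishing dissipation rate into
  convergence of the state.\<close>

lemma tendsto_of_positive_definite_tendsto_0:
  fixes X :: "real \<Rightarrow> 'x::heine_borel" and W :: "'x \<Rightarrow> real"
  assumes cont: "continuous_on UNIV W" and pos: "\<And>p. p \<noteq> a \<Longrightarrow> 0 < W p"
    and bdd: "bounded (X ` {0..})" and lim: "((\<lambda>t. W (X t)) \<longlongrightarrow> 0) at_top"
  shows "(X \<longlongrightarrow> a) at_top"
proof (rule tendstoI)
  fix e :: real assume e: "0 < e"
  define K where "K = closure (X ` {0..}) - ball a e"
  have K: "compact K" unfolding K_def
    using bdd by (intro compact_diff) (auto simp: compact_closure)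
  obtain c where c: "0 < c" "\<And>p. p \<in> K \<Longrightarrow> c \<le> W p"
  proof (cases "K = {}")
    case True then show ?thesis using that[of 1] by auto
  next
    case False
    obtain q where q: "q \<in> K" "\<And>p. p \<in> K \<Longrightarrow> W q \<le> W p"
      using continuous_attains_inf[OF K False continuous_on_subset[OF cont]] by auto
    show ?thesis using that[of "W q"] q pos[of q] e by (force simp: K_def)
  qed
  have "\<forall>\<^sub>F t in at_top. dist (W (X t)) 0 < c" by (rule tendstoD[OF lim c(1)])
  then show "\<forall>\<^sub>F t in at_top. dist (X t) a < e"
    using eventually_ge_at_top[of 0]
  proof eventually_elim
    case (elim t)
    then have "X t \<notin> K" using c(2)[of "X t"] by auto
    moreover have "X t \<in> closure (X ` {0..})" using elim closure_subset[of "X ` {0..}"] by auto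
    ultimately show ?case by (auto simp: K_def dist_commute)
  qed
qed

lemma nonpos_vector_derivative_imp_decreasing:
  fixes V :: "real \<Rightarrow> real"
  assumes deriv: "\<And>t. 0 \<le> t \<Longrightarrow> (V has_vector_derivative V' t) (at t within {0..})"
    and nonpos: "\<And>t. 0 \<le> t \<Longrightarrow> V' t \<le> 0" and st: "0 \<le> s" "s \<le> t"
  shows "V t \<le> V s"
proof (cases "s = t")
  case False
  have "\<exists>x\<in>{s<..<t}. V t - V s = (t - s) *\<^sub>R V' x"
    using False st
    by (intro mvt_simple has_vector_derivative_within_subset[OF deriv, unfolded
        has_vector_derivative_def]) auto
  then show ?thesis using st nonpos by (auto simp: mult_nonneg_nonpos)
      (smt (verit) mult_nonneg_nonpos)
qed simp

lemma bounded_vector_derivative_imp_uniformly_continuous: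
  fixes X :: "real \<Rightarrow> 'x::real_normed_vector"
  assumes deriv: "\<And>t. 0 \<le> t \<Longrightarrow> (X has_vector_derivative w t) (at t within {0..})"
    and bdd: "bounded (w ` {0..})"
  shows "uniformly_continuous_on {0..} X"
proof -
  obtain C where C: "\<And>t. 0 \<le> t \<Longrightarrow> norm (w t) \<le> C" "0 < C"
    using bdd unfolding bounded_pos by auto
  have "C-lipschitz_on {0..} X"
  proof (rule bounded_derivative_imp_lipschitz)
    show "(X has_derivative (\<lambda>h. h *\<^sub>R w t)) (at t within {0..})" if "t \<in> {0..}" for t
      using deriv that by (auto simp: has_vector_derivative_def)
    show "onorm (\<lambda>h. h *\<^sub>R w t) \<le> C" if "t \<in> {0..}" for t
      using C(1)[of t] C(2) that by (intro onorm_le) (simp add: mult.commute[of C] mult_left_mono)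
  qed (use C in auto)
  then show ?thesis by (rule lipschitz_on_uniformly_continuous)
qed

text \<open>Heine-Cantor on the compact closure of the range: plain continuity of \<open>g\<close>
  suffices along a bounded orbit.\<close>

lemma uniformly_continuous_on_compose_bounded:
  fixes X :: "real \<Rightarrow> 'x::heine_borel" and g :: "'x \<Rightarrow> 'y::metric_space"
  assumes "uniformly_continuous_on T X" "bounded (X ` T)" "continuous_on UNIV g"
  shows "uniformly_continuous_on T (\<lambda>t. g (X t))"
proof (rule uniformly_continuous_on_compose[OF assms(1)])
  have "uniformly_continuous_on (closure (X ` T)) g"
    using assms by (intro compact_uniformly_continuous continuous_on_subset[OF assms(3)])
        (auto simp: compact_closure)
  then show "uniformly_continuous_on (X ` T) g"
    using closure_subset[of "X ` T"] unfolding uniformly_continuous_on_def by (meson subsetD)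
qed

subsection \<open>Abstract saddle flows\<close>

text \<open>\<open>S\<close> and \<open>R\<close> are the inverses of the gains \<open>P\<close> and \<open>Q\<close>; \<open>D'\<close> is the adjoint of \<open>D\<close>.\<close>

locale saddle_flow =
  fixes X :: "real \<Rightarrow> 'x::euclidean_space" and Z :: "real \<Rightarrow> 'z::euclidean_space"
    and G :: "'x \<Rightarrow> 'x" and D :: "'z \<Rightarrow> 'x" and D' :: "'x \<Rightarrow> 'z"
    and P S :: "'x \<Rightarrow> 'x" and Q R :: "'z \<Rightarrow> 'z" and a :: 'x
  assumes X_deriv: "0 \<le> t \<Longrightarrow> (X has_vector_derivative P (- G (X t) - D (Z t))) (at t within {0..})"
    and Z_deriv: "0 \<le> t \<Longrightarrow> (Z has_vector_derivative Q (D' (X t))) (at t within {0..})"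
    and linP: "bounded_linear P" and linS: "bounded_linear S"
    and linQ: "bounded_linear Q" and linR: "bounded_linear R"
    and linD: "bounded_linear D" and linD': "bounded_linear D'"
    and adj: "D z \<bullet> p = z \<bullet> D' p"
    and SP: "S (P p) = p" and RQ: "R (Q z) = z"
    and symS: "p \<bullet> S q = S p \<bullet> q" and symR: "z \<bullet> R v = R z \<bullet> v"
    and coerS: "\<exists>c>0. \<forall>p. c * (norm p)\<^sup>2 \<le> p \<bullet> S p"
    and coerR: "\<exists>c>0. \<forall>z. c * (norm z)\<^sup>2 \<le> z \<bullet> R z"
    and contG: "continuous_on UNIV G"
    and D'a: "D' a = 0"
    and mono: "p \<noteq> a \<Longrightarrow> 0 < (p - a) \<bullet> (G p - G a)"
begin

text \<open>The reference point \<open>b\<close> is a parameter because two energies are needed: one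
  for a given equilibrium and one for a limit point of \<open>Z\<close>.\<close>

definition energy :: "'z \<Rightarrow> real \<Rightarrow> real"
  where "energy b t = ((X t - a) \<bullet> S (X t - a) + (Z t - b) \<bullet> R (Z t - b)) / 2"

text \<open>\<open>S\<close> and \<open>R\<close> undo the gains \<open>P\<close> and
  \<open>Q\<close>. By adjointness and \<open>D' a = 0\<close>, the contribution of \<open>Z\<close>
  is \<open>(X t - a) \<bullet> D (Z t - b)\<close>, and the equilibrium condition replaces
  \<open>- D b\<close> by \<open>G a\<close>. The terms with \<open>D (Z t)\<close> then
  cancel.\<close>

lemma energy_deriv:
  assumes b: "G a + D b = 0" and t: "0 \<le> t"
  shows "(energy b has_vector_derivative - ((X t - a) \<bullet> (G (X t) - G a))) (at t within {0..})"
proof -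
  interpret S: bounded_linear S by (rule linS)
  interpret R: bounded_linear R by (rule linR)
  interpret D: bounded_linear D by (rule linD)
  interpret D': bounded_linear D' by (rule linD')
  \<comment> \<open>Product rule for a quadratic form; symmetry of \<open>T\<close> merges its two
    terms, giving the factor 2.\<close>
  have half: "((\<lambda>t. (Y t - y) \<bullet> T (Y t - y)) has_vector_derivative 2 * ((Y t - y) \<bullet> T w))
      (at t within {0..})"
    if T: "bounded_linear T" "\<And>p q. p \<bullet> T q = T p \<bullet> q"
      and Y: "(Y has_vector_derivative w) (at t within {0..})"
    for Y :: "real \<Rightarrow> 'c::euclidean_space" and y w T
  proof -
    have 1: "((\<lambda>t. Y t - y) has_vector_derivative w) (at t within {0..})"
      using has_vector_derivative_diff[OF Y has_vector_derivative_const] by simp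
    show ?thesis
      using bounded_bilinear.has_vector_derivative[OF bounded_bilinear_inner 1
          bounded_linear.has_vector_derivative[OF T(1) 1]]
      by (simp add: T(2)[of w] inner_commute[of w] T(2)[symmetric])
  qed
  have "(energy b has_vector_derivative
      (1/2) *\<^sub>R (2 * ((X t - a) \<bullet> S (P (- G (X t) - D (Z t))))
          + 2 * ((Z t - b) \<bullet> R (Q (D' (X t)))))) (at t within {0..})"
    unfolding energy_def
    using bounded_linear.has_vector_derivative[OF bounded_linear_scaleR_right[of "1/2"]
     has_vector_derivative_add[OF half[OF linS symS X_deriv[OF t], of a] half[OF linR symR
         Z_deriv[OF t], of b]]]
    by simp
  moreover have "(Z t - b) \<bullet> D' (X t) = (X t - a) \<bullet> (D (Z t) + G a)"
  proof -
    have "(Z t - b) \<bullet> D' (X t) = (Z t - b) \<bullet> D' (X t - a)" by (simp add: D'.diff D'a)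
    also have "\<dots> = (X t - a) \<bullet> D (Z t - b)" by (simp add: adj[symmetric] inner_commute)
    also have "D (Z t - b) = D (Z t) + G a" using b by (simp add: D.diff diff_eq_eq add.assoc)
    finally show ?thesis .
  qed
  moreover have "(X t - a) \<bullet> (- G (X t) - D (Z t)) + (X t - a) \<bullet> (D (Z t) + G a)
      = - ((X t - a) \<bullet> (G (X t) - G a))"
    by (simp flip: inner_add_right inner_minus_right)
  ultimately show ?thesis
    by (simp only: SP RQ flip: distrib_left) simp
qed

lemma G_monotone: "0 \<le> (p - a) \<bullet> (G p - G a)"
  using mono[of p] by (cases "p = a") auto

text \<open>Coercivity of \<open>S\<close> and \<open>R\<close>. The constants (2/c and 2/k) depend
  on neither \<open>b\<close> nor \<open>t\<close>, so they serve every reference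
  equilibrium.\<close>

lemma energy_nonneg: "0 \<le> energy b t"
  and X_bound: "\<exists>C. \<forall>b t. (norm (X t - a))\<^sup>2 \<le> C * energy b t"
  and Z_bound: "\<exists>C. \<forall>b t. (norm (Z t - b))\<^sup>2 \<le> C * energy b t"
proof -
  obtain c where c: "c > 0" "\<And>p. c * (norm p)\<^sup>2 \<le> p \<bullet> S p" using coerS by auto
  obtain k where k: "k > 0" "\<And>p. k * (norm p)\<^sup>2 \<le> p \<bullet> R p" using coerR by auto
  have 1: "c * (norm (X t - a))\<^sup>2 + k * (norm (Z t - b))\<^sup>2 \<le> 2 * energy b t" for b t
    unfolding energy_def using c(2)[of "X t - a"] k(2)[of "Z t - b"] by simp
  have 2: "0 \<le> c * (norm (X t - a))\<^sup>2" "0 \<le> k * (norm (Z t - b))\<^sup>2" for b t using c k by auto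
  show "0 \<le> energy b t" using 1[of t b] 2 by (smt (verit))
  have "c * (norm (X t - a))\<^sup>2 \<le> 2 * energy b t" "k * (norm (Z t - b))\<^sup>2 \<le> 2 * energy b t" for b t
    using 1[of t b] 2(1)[of t] 2(2)[of t b] by linarith+
  then have "(norm (X t - a))\<^sup>2 \<le> 2 / c * energy b t" "(norm (Z t - b))\<^sup>2 \<le> 2 / k * energy b t"
      for b t
    using c(1) k(1) by (simp_all add: field_simps)
  then show "\<exists>C. \<forall>b t. (norm (X t - a))\<^sup>2 \<le> C * energy b t"
    "\<exists>C. \<forall>b t. (norm (Z t - b))\<^sup>2 \<le> C * energy b t"
    by blast+
qed

lemma energy_decreasing:
  assumes "G a + D b = 0" "0 \<le> s" "s \<le> t"
  shows "energy b t \<le> energy b s"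
  by (rule nonpos_vector_derivative_imp_decreasing[OF energy_deriv[OF assms(1)]])
    (use assms G_monotone in auto)

lemma stationary:
  assumes b: "G a + D b = 0" and init: "X 0 = a" "Z 0 = b" and t: "0 \<le> t"
  shows "X t = a" "Z t = b"
proof -
  interpret S: bounded_linear S by (rule linS)
  interpret R: bounded_linear R by (rule linR)
  have "energy b 0 = 0" using init by (simp add: energy_def S.zero R.zero)
  then have 0: "energy b t = 0"
    using energy_decreasing[OF b order_refl t] energy_nonneg[of b t] by simp
  obtain C where "(norm (X t - a))\<^sup>2 \<le> C * energy b t" using X_bound by blast
  then show "X t = a" using 0 by simp
  obtain C where "(norm (Z t - b))\<^sup>2 \<le> C * energy b t" using Z_bound by blast
  then show "Z t = b" using 0 by simp
qed

lemma bounded_flow: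
  assumes b: "G a + D b = 0"
  shows "bounded (X ` {0..})" "bounded (Z ` {0..})"
proof -
  have *: "bounded (Y ` {0..})"
    if Y: "\<exists>C. \<forall>t. (norm (Y t - y))\<^sup>2 \<le> C * energy b t" for Y :: "real \<Rightarrow> 'c::euclidean_space"
        and y :: 'c
  proof -
    obtain C where C: "\<And>t. (norm (Y t - y))\<^sup>2 \<le> C * energy b t" using Y by auto
    have "norm (Y t - y) \<le> sqrt (\<bar>C\<bar> * energy b 0)" if t: "0 \<le> t" for t
    proof (rule real_le_rsqrt)
      \<comment> \<open>The constant obtained from \<open>Y\<close> comes without a sign, hence the
        absolute value.\<close>
      have "C * energy b t \<le> \<bar>C\<bar> * energy b 0"
        using energy_decreasing[OF b order_refl t] energy_nonneg[of b t] by (intro mult_mono) auto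
      then show "(norm (Y t - y))\<^sup>2 \<le> \<bar>C\<bar> * energy b 0" using C[of t] by linarith
    qed
    then have "Y ` {0..} \<subseteq> cball y (sqrt (\<bar>C\<bar> * energy b 0))"
      by (auto simp: dist_norm norm_minus_commute)
    then show ?thesis using bounded_cball bounded_subset by blast
  qed
  show "bounded (X ` {0..})" using X_bound by (intro *[of X a]) blast
  show "bounded (Z ` {0..})" using Z_bound by (intro *[of Z b]) blast
qed

text \<open>The limit \<open>b'\<close> may differ from the given \<open>b\<close>, as
  \<open>D\<close> need not be injective; \<open>b\<close> serves for boundedness and for the first
  energy argument.\<close>

theorem converges:
  assumes b: "G a + D b = 0"
  obtains b' where "G a + D b' = 0" "(X \<longlongrightarrow> a) at_top" "(Z \<longlongrightarrow> b') at_top"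
proof -
  note bX = bounded_flow(1)[OF b] and bZ = bounded_flow(2)[OF b]
  interpret D: bounded_linear D by (rule linD)
  interpret S: bounded_linear S by (rule linS)
  have bounded_comp: "bounded ((\<lambda>t. g (Y t)) ` {0..})"
    if "bounded (Y ` {0..})" "continuous_on UNIV g" for Y :: "real \<Rightarrow> 'c::euclidean_space"
        and g :: "'c \<Rightarrow> 'd::euclidean_space"
  proof -
    have "compact (g ` closure (Y ` {0..}))"
      using that by (intro compact_continuous_image continuous_on_subset[OF that(2)])
          (auto simp: compact_closure)
    then have "bounded (g ` closure (Y ` {0..}))" by (rule compact_imp_bounded)
    then show ?thesis by (rule bounded_subset) (use closure_subset in fastforce)
  qed
  define w where "w t = P (- G (X t) - D (Z t))" for t
  define F where "F = (\<lambda>(p, z). P (- G p - D z))"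
  have contF: "continuous_on UNIV F"
    unfolding F_def case_prod_unfold
    by (intro bounded_linear.continuous_on[OF linP] bounded_linear.continuous_on[OF linD]
        continuous_intros
       continuous_on_compose2[OF contG]) auto
  have bXZ: "bounded ((\<lambda>t. (X t, Z t)) ` {0..})"
    by (rule bounded_subset[OF bounded_Times[OF bX bZ]]) auto
  have bw: "bounded (w ` {0..})"
    using bounded_comp[OF bXZ contF] by (simp add: w_def F_def)
  have bw': "bounded ((\<lambda>t. Q (D' (X t))) ` {0..})"
    by (rule bounded_comp[OF bX])
      (intro bounded_linear.continuous_on[OF linQ] bounded_linear.continuous_on[OF linD']
          continuous_on_id)
  have dX: "\<And>t. 0 \<le> t \<Longrightarrow> (X has_vector_derivative w t) (at t within {0..})"
    using X_deriv by (simp add: w_def)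
  have ucXZ: "uniformly_continuous_on {0..} (\<lambda>t. (X t, Z t))"
  proof (rule bounded_vector_derivative_imp_uniformly_continuous)
    show "((\<lambda>t. (X t, Z t)) has_vector_derivative (w t, Q (D' (X t)))) (at t within {0..})"
      if "0 \<le> t" for t
      using has_vector_derivative_Pair[OF dX[OF that] Z_deriv[OF that]] .
    show "bounded ((\<lambda>t. (w t, Q (D' (X t)))) ` {0..})"
      by (rule bounded_subset[OF bounded_Times[OF bw bw']]) auto
  qed
  define W where "W p = (p - a) \<bullet> (G p - G a)" for p
  have contW: "continuous_on UNIV W"
    unfolding W_def by (intro continuous_intros contG)
  have V: "(energy b has_vector_derivative - W (X t)) (at t within {0..})" if "0 \<le> t" for t
    using energy_deriv[OF b that] by (simp add: W_def)
  obtain l where l: "(energy b \<longlongrightarrow> l) at_top"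
    by (rule decreasing_bounded_below_convergent[OF energy_decreasing[OF b] energy_nonneg])
  \<comment> \<open>The rate is read as a function of the pair \<open>(X, Z)\<close>, whose
    boundedness and uniform continuity are already established.\<close>
  have "continuous_on UNIV (\<lambda>q :: 'x \<times> 'z. - W (fst q))"
    by (intro continuous_intros continuous_on_compose2[OF contW]) auto
  from uniformly_continuous_on_compose_bounded[OF ucXZ bXZ this]
  have "uniformly_continuous_on {0..} (\<lambda>t. - W (X t))" by simp
  from tendsto_minus[OF barbalat[OF V this l]] have "((\<lambda>t. W (X t)) \<longlongrightarrow> 0) at_top" by simp
  then have Xa: "(X \<longlongrightarrow> a) at_top"
    using mono by (intro tendsto_of_positive_definite_tendsto_0[OF contW _ bX]) (auto simp: W_def)
  have "uniformly_continuous_on {0..} w"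
    using uniformly_continuous_on_compose_bounded[OF ucXZ bXZ contF]
        by (simp add: F_def flip: w_def)
  \<comment> \<open>Since \<open>S\<close> inverts \<open>P\<close>, a vanishing velocity forces the
    argument of \<open>P\<close> to vanish in the limit.\<close>
  from S.tendsto[OF barbalat[OF dX this Xa]] have "((\<lambda>t. S (w t)) \<longlongrightarrow> S 0) at_top" .
  then have lim0: "((\<lambda>t. - G (X t) - D (Z t)) \<longlongrightarrow> 0) at_top"
    by (simp add: w_def SP S.zero)
  have GX: "((\<lambda>t. G (X t)) \<longlongrightarrow> G a) at_top"
    using contG Xa by (intro continuous_on_tendsto_compose[of UNIV G]) auto
  have DZ: "((\<lambda>t. D (Z t)) \<longlongrightarrow> - G a) at_top"
    using tendsto_minus[OF tendsto_add[OF lim0 GX]] by simp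
  obtain b' r where r: "strict_mono r" "((\<lambda>n. Z (real n)) \<circ> r) \<longlonglongrightarrow> b'"
  proof -
    have "bounded (range (\<lambda>n. Z (real n)))" by (rule bounded_subset[OF bZ]) auto
    from bounded_imp_convergent_subsequence[OF this] show ?thesis using that by blast
  qed
  have real_r: "filterlim (\<lambda>n. real (r n)) at_top sequentially"
    by (intro filterlim_compose[OF filterlim_real_sequentially] filterlim_subseq r)
  have "(\<lambda>n. D (Z (real (r n)))) \<longlonglongrightarrow> D b'"
    using D.tendsto[OF r(2)] by (simp add: o_def)
  \<comment> \<open>\<open>D (Z t)\<close> converges along all times, although \<open>Z\<close> is
    so far known to converge only along a subsequence.\<close>
  then have "D b' = - G a"
    using filterlim_compose[OF DZ real_r] LIMSEQ_unique by blast
  then have b': "G a + D b' = 0" by simp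
  obtain l' where l': "(energy b' \<longlongrightarrow> l') at_top"
    by (rule decreasing_bounded_below_convergent[OF energy_decreasing[OF b'] energy_nonneg])
  have "(\<lambda>n. energy b' (real (r n))) \<longlonglongrightarrow> ((a - a) \<bullet> S (a - a) + (b' - b') \<bullet> R (b' - b')) / 2"
    unfolding energy_def using r(2) filterlim_compose[OF Xa real_r]
    by (intro tendsto_intros bounded_linear.tendsto[OF linS] bounded_linear.tendsto[OF linR])
        (auto simp: o_def)
  \<comment> \<open>The limit \<open>l'\<close> over all times exists by monotonicity, so the
    subsequence determines it.\<close>
  then have "l' = 0"
    using LIMSEQ_unique[OF filterlim_compose[OF l' real_r]] by simp
  obtain C where C: "\<And>t. (norm (Z t - b'))\<^sup>2 \<le> C * energy b' t" using Z_bound by blast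
  have "((\<lambda>t. (norm (Z t - b'))\<^sup>2) \<longlongrightarrow> 0) at_top"
  proof (rule tendsto_sandwich[OF _ _ tendsto_const])
    show "((\<lambda>t. C * energy b' t) \<longlongrightarrow> 0) at_top"
      using tendsto_mult[OF tendsto_const l', of C] \<open>l' = 0\<close> by simp
  qed (use C in auto)
  from tendsto_real_sqrt[OF this] have "(Z \<longlongrightarrow> b') at_top"
    by (subst tendsto_dist_iff) (simp add: dist_norm)
  then show ?thesis using that b' Xa by blast
qed

end

subsection \<open>Gradients of convex functions\<close>

text \<open>Riesz representation: the vector \<open>adjoint L 1\<close> represents the derivative
  \<open>L\<close>. Uniqueness of the derivative makes the definite description in
  \<open>gradient\<close> meaningful.\<close>

lemma GDERIV_gradient:
  fixes g :: "'v::euclidean_space \<Rightarrow> real"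
  assumes "g differentiable (at p)"
  shows "GDERIV g p :> gradient g p"
proof -
  obtain L where L: "(g has_derivative L) (at p)" using assms by (auto simp: differentiable_def)
  have "L h = h \<bullet> adjoint L 1" for h
    using adjoint_works[OF has_derivative_linear[OF L], of h 1] by simp
  then have "L = (\<lambda>h. h \<bullet> adjoint L 1)" by auto
  with L have D: "GDERIV g p :> adjoint L 1" by (simp add: gderiv_def)
  show ?thesis unfolding gradient_def
  proof (rule theI[of "\<lambda>D. GDERIV g p :> D", OF D])
    fix D' assume "GDERIV g p :> D'"
    then have "(\<lambda>h. h \<bullet> D') = (\<lambda>h. h \<bullet> adjoint L 1)"
      using D unfolding gderiv_def by (rule has_derivative_unique)
    then have "\<forall>h. h \<bullet> D' = h \<bullet> adjoint L 1" by (intro allI) (rule fun_cong)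
    then show "D' = adjoint L 1" by (simp only: vector_eq_ldot)
  qed
qed

text \<open>Restricted to the line through \<open>p\<close> and \<open>q\<close>, the claim is the
  tangent inequality of a convex function of one variable, with tangent at 0 and evaluation at
  1.\<close>

lemma convex_above_tangent_plane:
  fixes g :: "'v::real_inner \<Rightarrow> real"
  assumes conv: "convex_on UNIV g" and D: "GDERIV g p :> D"
  shows "g p + (q - p) \<bullet> D \<le> g q"
proof -
  define h where "h s = g (p + s *\<^sub>R (q - p))" for s
  have "convex_on UNIV h"
  proof (rule convex_onI)
    fix t x y :: real assume t: "0 < t" "t < 1"
    have "p + ((1 - t) *\<^sub>R x + t *\<^sub>R y) *\<^sub>R (q - p) =
      (1 - t) *\<^sub>R (p + x *\<^sub>R (q - p)) + t *\<^sub>R (p + y *\<^sub>R (q - p))"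
      by (simp add: algebra_simps)
    then show "h ((1 - t) *\<^sub>R x + t *\<^sub>R y) \<le> (1 - t) * h x + t * h y"
      using convex_onD[OF conv, of t "p + x *\<^sub>R (q - p)" "p + y *\<^sub>R (q - p)"] t
      by (simp only: h_def) simp
  qed simp
  moreover have "(h has_field_derivative ((q - p) \<bullet> D)) (at 0 within UNIV)"
  proof -
    have "((\<lambda>s. p + s *\<^sub>R (q - p)) has_derivative (\<lambda>s. s *\<^sub>R (q - p))) (at 0)"
      by (auto intro!: derivative_eq_intros)
    moreover have "(g has_derivative (\<lambda>h. h \<bullet> D)) (at (p + 0 *\<^sub>R (q - p)))"
      using D by (simp add: gderiv_def)
    ultimately have "(h has_derivative (\<lambda>s. (s *\<^sub>R (q - p)) \<bullet> D)) (at 0)"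
      unfolding h_def by (rule has_derivative_compose)
    then show ?thesis by (simp add: has_field_derivative_def mult_commute_abs)
  qed
  ultimately have "(q - p) \<bullet> D * (1 - 0) \<le> h 1 - h 0"
    by (intro convex_on_imp_above_tangent[of UNIV]) auto
  then show ?thesis by (simp add: h_def)
qed

text \<open>Only differentiability is assumed, while the limit arguments need a continuous vector
  field; convexity supplies it. A gradient at \<open>q\<close> far from that at \<open>p\<close>
  would make the tangent plane at \<open>q\<close> exceed the first-order expansion at
  \<open>p\<close> at a nearby test point.\<close>

lemma continuous_on_gradient_convex:
  fixes g :: "'v::euclidean_space \<Rightarrow> real"
  assumes conv: "convex_on UNIV g" and diff: "\<And>p. g differentiable (at p)"
  shows "continuous_on UNIV (gradient g)"
proof (rule continuous_at_imp_continuous_on, intro ballI)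
  fix p :: 'v
  define N where "N = gradient g"
  note D = GDERIV_gradient[OF diff, folded N_def]
  show "isCont (gradient g) p"
    unfolding continuous_at_eps_delta N_def[symmetric]
  proof (intro allI impI)
    fix e :: real assume e: "0 < e"
    \<comment> \<open>The slope e/4 is chosen so that an error over distance 2r/3, divided by the
      test step r/3, leaves e/2.\<close>
    obtain r where r: "0 < r" "\<And>y. norm (y - p) < r \<Longrightarrow>
        norm (g y - g p - (y - p) \<bullet> N p) \<le> e/4 * norm (y - p)"
      using D[of p] e unfolding gderiv_def has_derivative_at_alt
          by (metis divide_pos_pos zero_less_numeral)
    have "dist (N q) (N p) < e" if q: "dist q p < r/3" for q
    proof -
      define w where "w = N q - N p"
      \<comment> \<open>The test point moves from \<open>q\<close> in the direction of the gradient
        difference, so that \<open>(y - q) \<bullet> w\<close> is r/3 times the norm of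
        \<open>w\<close>. If \<open>w = 0\<close>, then \<open>sgn w = 0\<close> and
        \<open>y = q\<close>.\<close>
      define y where "y = q + (r/3) *\<^sub>R sgn w"
      have "norm (y - q) \<le> r/3" using r by (simp add: y_def norm_sgn)
      then have yp: "norm (y - p) < r" "norm (y - p) \<le> 2*r/3"
        using q norm_triangle_ineq[of "y - q" "q - p"] r by (auto simp: dist_norm)
      have "g y - g p - (y - p) \<bullet> N p \<le> e/4 * norm (y - p)"
        using r(2)[OF yp(1)] unfolding real_norm_def by (rule abs_le_D1)
      moreover have "e/4 * norm (y - p) \<le> e/4 * (2*r/3)"
        using yp e by (intro mult_left_mono) auto
      moreover have "g q + (y - q) \<bullet> N q \<le> g y" "g p + (q - p) \<bullet> N p \<le> g q"
        by (intro convex_above_tangent_plane[OF conv D])+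
      \<comment> \<open>In the sum of the three estimates all values of \<open>g\<close>
        cancel.\<close>
      ultimately have "(y - q) \<bullet> w \<le> e/4 * (2*r/3)"
        by (simp add: w_def inner_diff_left inner_diff_right)
      moreover have "(y - q) \<bullet> w = r/3 * norm w"
        by (cases "w = 0") (simp_all add: y_def sgn_div_norm power2_norm_eq_inner[symmetric]
            power2_eq_square)
      ultimately have "r/3 * norm w \<le> r/3 * (e/2)" by (simp add: algebra_simps)
      then have "norm w \<le> e/2" using r(1) by simp
      then show ?thesis using e by (simp add: dist_norm w_def)
    qed
    then show "\<exists>d>0. \<forall>q. dist q p < d \<longrightarrow> dist (N q) (N p) < e"
      using r(1) by (intro exI[of _ "r/3"]) auto
  qed
qed

lemma gradient_monotone:
  fixes g :: "'v::euclidean_space \<Rightarrow> real"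
  assumes conv: "convex_on UNIV g" and diff: "\<And>p. g differentiable (at p)"
  shows "0 \<le> (p - q) \<bullet> (gradient g p - gradient g q)"
  using convex_above_tangent_plane[OF conv GDERIV_gradient[OF diff], of p q]
    convex_above_tangent_plane[OF conv GDERIV_gradient[OF diff], of q p]
  by (simp add: inner_diff_left inner_diff_right)

text \<open>Otherwise the tangent planes at \<open>p\<close> show that \<open>p\<close> is a
  minimizer as well, and strict convexity puts the midpoint of \<open>p\<close> and \<open>a\<close>
  below the minimum.\<close>

lemma strictly_convex_sum_gradient_pos:
  fixes f :: "'i::finite \<Rightarrow> 'v::euclidean_space \<Rightarrow> real"
  assumes conv: "\<And>i. convex_on UNIV (f i)" and diff: "\<And>i p. f i differentiable (at p)"
    and strict: "strictly_convex (\<lambda>p. \<Sum>i\<in>UNIV. f i p)"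
    and min: "\<And>p. (\<Sum>i\<in>UNIV. f i a) \<le> (\<Sum>i\<in>UNIV. f i p)"
    and neq: "p \<noteq> a"
  shows "0 < (p - a) \<bullet> (\<Sum>i\<in>UNIV. gradient (f i) p)"
proof (rule ccontr)
  let ?F = "\<lambda>p. \<Sum>i\<in>UNIV. f i p"
  assume "\<not> ?thesis"
  moreover have "(\<Sum>i\<in>UNIV. f i p + (a - p) \<bullet> gradient (f i) p) \<le> ?F a"
    by (intro sum_mono convex_above_tangent_plane conv GDERIV_gradient diff)
  moreover have "(\<Sum>i\<in>UNIV. f i p + (a - p) \<bullet> gradient (f i) p)
      = ?F p - (p - a) \<bullet> (\<Sum>i\<in>UNIV. gradient (f i) p)"
    by (simp only: sum.distrib flip: inner_sum_right) (simp add: inner_diff_left)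
  ultimately have "?F p \<le> ?F a" by linarith
  moreover define m where "m = (1 - 1/2) *\<^sub>R p + (1/2) *\<^sub>R a"
  moreover have "?F m < (1 - 1/2) * ?F p + (1/2) * ?F a" unfolding m_def
    by (rule strict[unfolded strictly_convex_def, rule_format]) (use neq in auto)
  ultimately show False using min[of m] by simp
qed

lemma sum_gradient_at_minimizer:
  fixes f :: "'i::finite \<Rightarrow> 'v::euclidean_space \<Rightarrow> real"
  assumes diff: "\<And>i p. f i differentiable (at p)"
    and min: "\<And>p. (\<Sum>i\<in>UNIV. f i a) \<le> (\<Sum>i\<in>UNIV. f i p)"
  shows "(\<Sum>i\<in>UNIV. gradient (f i) a) = 0"
proof -
  have "((\<lambda>p. \<Sum>i\<in>UNIV. f i p) has_derivative (\<lambda>h. \<Sum>i\<in>UNIV. h \<bullet> gradient (f i) a)) (at a)"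
    using GDERIV_gradient[OF diff] by (intro has_derivative_sum) (auto simp: gderiv_def)
  then have "(\<lambda>h. \<Sum>i\<in>UNIV. h \<bullet> gradient (f i) a) = (\<lambda>h. 0)"
    by (rule has_derivative_local_min) (use min in auto)
  then have "h \<bullet> (\<Sum>i\<in>UNIV. gradient (f i) a) = 0" for h
    unfolding inner_sum_right by (rule fun_cong)
  then show ?thesis using inner_eq_zero_iff by blast
qed

subsection \<open>Stacked vectors and the interconnection\<close>

lemma has_vector_derivative_vec_lambda:
  fixes x :: "'i::finite \<Rightarrow> real \<Rightarrow> 'v::real_normed_vector"
  assumes "\<And>i. (x i has_vector_derivative x' i) F"
  shows "((\<lambda>t. \<chi> i. x i t) has_vector_derivative (\<chi> i. x' i)) F"
  unfolding has_vector_derivative_def has_derivative_def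
proof (intro conjI bounded_linear_scaleR_left vec_tendstoI)
  fix i
  \<comment> \<open>\<open>Lim F (\<lambda>x. x)\<close> is the base point of the derivative, left
    in this form because \<open>F\<close> is an arbitrary filter.\<close>
  show "((\<lambda>y. (((\<chi> i. x i y) - (\<chi> i. x i (Lim F (\<lambda>x. x))) - (y - Lim F (\<lambda>x. x)) *\<^sub>R (\<chi> i. x' i)) /\<^sub>R
              norm (y - Lim F (\<lambda>x. x))) $ i) \<longlongrightarrow> 0 $ i) F"
    using assms[of i] by (simp add: has_vector_derivative_def has_derivative_def)
qed

text \<open>Stacked vectors are kept nested here instead of flattened by \<open>col\<close>, so that
  inner products, limits and derivatives can be taken block by block.\<close>

definition block_scale :: "('i::finite \<Rightarrow> real) \<Rightarrow> (real ^ 'n::finite) ^ 'i \<Rightarrow> (real ^ 'n) ^ 'i"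
  where "block_scale c v = (\<chi> i. c i *\<^sub>R v $ i)"

lemma block_scale_nth [simp]: "block_scale c v $ i = c i *\<^sub>R v $ i"
  by (simp add: block_scale_def)

lemma block_scale_zero [simp]: "block_scale c 0 = 0"
  by (simp add: block_scale_def vec_eq_iff)

text \<open>\<open>block_mult E v\<close> is \<open>(E \<otimes> I) v\<close> for a stacked vector kept as a vector of blocks.\<close>

definition block_mult :: "real ^ 'k ^ 'a \<Rightarrow> (real ^ 'n::finite) ^ 'k::finite \<Rightarrow>
    (real ^ 'n) ^ 'a::finite"
  where "block_mult E v = (\<chi> i. \<Sum>k\<in>UNIV. E $ i $ k *\<^sub>R v $ k)"

lemma block_mult_zero [simp]: "block_mult E 0 = 0"
  by (simp add: block_mult_def vec_eq_iff)

lemma bounded_linear_block_scale: "bounded_linear (block_scale c)"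
  unfolding linear_conv_bounded_linear[symmetric]
  by (rule linearI) (auto simp: block_scale_def vec_eq_iff algebra_simps)

lemma bounded_linear_block_mult: "bounded_linear (block_mult E)"
  unfolding linear_conv_bounded_linear[symmetric]
  by (rule linearI) (auto simp: block_mult_def vec_eq_iff algebra_simps sum.distrib
      sum_distrib_left)

lemma block_scale_symmetric: "p \<bullet> block_scale c q = block_scale c p \<bullet> q"
  by (simp add: block_scale_def inner_vec_def[where 'b = "'b"] mult.left_commute)

lemma block_mult_adjoint: "block_mult E v \<bullet> w = v \<bullet> block_mult (transpose E) w"
proof -
  have "block_mult E v \<bullet> w = (\<Sum>i\<in>UNIV. \<Sum>k\<in>UNIV. E $ i $ k * (v $ k \<bullet> w $ i))"
    by (simp add: block_mult_def inner_vec_def[of "vec_lambda _"] inner_sum_left)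
  also have "\<dots> = (\<Sum>k\<in>UNIV. \<Sum>i\<in>UNIV. E $ i $ k * (v $ k \<bullet> w $ i))" by (rule sum.swap)
  also have "\<dots> = v \<bullet> block_mult (transpose E) w"
    by (simp add: block_mult_def inner_vec_def[of _ "vec_lambda _"] inner_sum_right transpose_def)
  finally show ?thesis .
qed

text \<open>The constant is the smallest gain, which exists and is positive because the index type
  is finite.\<close>

lemma block_scale_coercive:
  assumes pos: "\<And>i. 0 < c i"
  shows "\<exists>m>0. \<forall>p :: (real ^ 'n::finite) ^ 'i::finite. m * (norm p)\<^sup>2 \<le> p \<bullet> block_scale c p"
proof (intro exI conjI allI)
  show "0 < Min (range c)" using pos by (auto simp: Min_gr_iff)
  fix p :: "(real ^ 'n) ^ 'i"
  have "(\<Sum>i\<in>UNIV. Min (range c) * (p $ i \<bullet> p $ i)) \<le> (\<Sum>i\<in>UNIV. c i * (p $ i \<bullet> p $ i))"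
    by (intro sum_mono mult_right_mono) auto
  then show "Min (range c) * (norm p)\<^sup>2 \<le> p \<bullet> block_scale c p"
    by (simp add: power2_norm_eq_inner block_scale_def inner_vec_def[of p] sum_distrib_left)
qed

lemma block_scale_inverse:
  assumes "\<And>i. c i \<noteq> 0"
  shows "block_scale (\<lambda>i. inverse (c i)) (block_scale c p) = p"
  using assms by (simp add: block_scale_def vec_eq_iff)

lemma kron_mult_col:
  fixes E :: "real ^ 'k::finite ^ 'a::finite" and v :: "'k \<Rightarrow> real ^ 'n::finite"
  shows "kron E (mat 1 :: real ^ 'n ^ 'n) *v col v = col (\<lambda>i. \<Sum>k\<in>UNIV. E $ i $ k *\<^sub>R v k)"
proof -
  have "(\<Sum>q\<in>UNIV. E $ i $ fst q * (if j = snd q then 1 else 0) * v (fst q) $ snd q)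
      = (\<Sum>k\<in>UNIV. E $ i $ k * v k $ j)"
    for i and j :: 'n
  proof -
    have "(\<Sum>q\<in>UNIV. E $ i $ fst q * (if j = snd q then 1 else 0) * v (fst q) $ snd q)
       = (\<Sum>k\<in>UNIV. \<Sum>l\<in>UNIV. if j = l then E $ i $ k * v k $ l else 0)"
      unfolding UNIV_Times_UNIV[symmetric] sum.cartesian_product' by (intro sum.cong) auto
    then show ?thesis by simp
  qed
  then show ?thesis
    by (simp add: kron_def col_def matrix_vector_mult_def mat_def vec_eq_iff)
qed

lemma transpose_kron_mat_1: "transpose (kron E (mat 1)) = kron (transpose E) (mat 1)"
  by (simp add: kron_def transpose_def mat_def vec_eq_iff eq_commute)

lemma col_inject: "col v = col w \<longleftrightarrow> v = w"
  by (auto simp: col_def vec_eq_iff fun_eq_iff)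

lemma minus_col: "- col v = col (\<lambda>i. - v i)"
  by (simp add: col_def vec_eq_iff)

text \<open>Bridge from the flattened Kronecker form to nested blocks: the identity factor acts on
  each block separately, and \<open>col\<close> is injective.\<close>

lemma interconnected_iff:
  "interconnected E u y \<zeta> d \<longleftrightarrow>
    (\<forall>k. \<zeta> k = block_mult (transpose E) (vec_lambda y) $ k) \<and>
      (\<forall>i. u i = - block_mult E (vec_lambda d) $ i)"
  by (simp add: interconnected_def transpose_kron_mat_1 kron_mult_col col_inject minus_col
      block_mult_def fun_eq_iff)

text \<open>The kernel condition is applied to each component \<open>j\<close> of the blocks. The
  constants so obtained, one for each \<open>j\<close>, assemble into the common block
  \<open>q\<close>.\<close>

lemma block_mult_transpose_eq_0_iff:
  fixes E :: "real ^ 'k::finite ^ 'a::finite" and p :: "(real ^ 'n::finite) ^ 'a"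
  assumes ker: "matrix_kernel (transpose E) = {c *\<^sub>R (1 :: real ^ 'a) | c. True}"
  shows "block_mult (transpose E) p = 0 \<longleftrightarrow> (\<exists>q. p = (\<chi> i. q))"
proof
  have comp: "block_mult (transpose E) p $ k $ j = (transpose E *v (\<chi> i. p $ i $ j)) $ k" for k j
      and p :: "(real ^ 'n) ^ 'a"
    by (simp add: block_mult_def matrix_vector_mult_def)
  {
    assume 0: "block_mult (transpose E) p = 0"
    have "\<exists>c. \<forall>i. p $ i $ j = c" for j
    proof -
      have "(\<chi> i. p $ i $ j) \<in> matrix_kernel (transpose E)"
        using 0 by (simp add: vec_eq_iff comp matrix_kernel_def)
      then show ?thesis unfolding ker by (auto simp: vec_eq_iff)
    qed
    then obtain c where "\<And>i j. p $ i $ j = c j" by metis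
    then show "\<exists>q. p = (\<chi> i. q)" by (intro exI[of _ "\<chi> j. c j"]) (simp add: vec_eq_iff)
  }
  assume "\<exists>q. p = (\<chi> i. q)"
  then obtain q where q: "p = (\<chi> i. q)" by blast
  have "(\<chi> i. p $ i $ j) \<in> matrix_kernel (transpose E)" for j
    unfolding ker q by (auto simp: vec_eq_iff intro!: exI[of _ "q $ j"])
  then show "block_mult (transpose E) p = 0"
    by (simp add: vec_eq_iff comp matrix_kernel_def)
qed

text \<open>Fredholm alternative: the range of \<open>block_mult E\<close> is the orthogonal
  complement of the kernel of its adjoint, that is, of the consensus vectors. Blocks that sum to
  zero are orthogonal to all of these.\<close>

lemma sum_eq_0_imp_in_range_block_mult:
  fixes E :: "real ^ 'k::finite ^ 'a::finite" and g :: "(real ^ 'n::finite) ^ 'a"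
  assumes ker: "matrix_kernel (transpose E) = {c *\<^sub>R (1 :: real ^ 'a) | c. True}"
    and g: "(\<Sum>i\<in>UNIV. g $ i) = 0"
  shows "g \<in> range (block_mult E)"
proof -
  have lin: "linear (block_mult A :: (real ^ 'n) ^ 'x \<Rightarrow> _)"
      for A :: "real ^ 'x::finite ^ 'y::finite"
    using bounded_linear_block_mult by (rule bounded_linear.linear)
  have "adjoint (block_mult (transpose E) :: (real ^ 'n) ^ 'a \<Rightarrow> _)
      = (block_mult E :: (real ^ 'n) ^ 'k \<Rightarrow> _)"
    by (intro adjoint_unique) (simp add: block_mult_adjoint)
  then have "(block_mult (transpose E) -` {0 :: (real ^ 'n) ^ 'k})\<^sup>\<bottom> = range (block_mult E)"
    using ker_orthogonal_comp_adjoint[OF lin, of "transpose E"]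
    by (simp add: orthogonal_comp_self linear_subspace_image[OF lin])
  moreover have "g \<in> (block_mult (transpose E) -` {0 :: (real ^ 'n) ^ 'k})\<^sup>\<bottom>"
  proof -
    have "(\<chi> i. q) \<bullet> g = q \<bullet> (\<Sum>i\<in>UNIV. g $ i)" for q
      by (simp add: inner_vec_def[of "vec_lambda _"] inner_sum_right)
    then show ?thesis
      using g by (auto simp: orthogonal_comp_def orthogonal_def
          block_mult_transpose_eq_0_iff[OF ker])
  qed
  ultimately show ?thesis by simp
qed

subsection \<open>The closed loop as a saddle flow\<close>

text \<open>Gradient of the augmented objective that adds half the sum of \<open>\<beta> k\<close>
  times the squared norm of \<open>\<zeta> k\<close>. The feedthrough in the controller output is
  thereby moved to the agents, and only the integrator states act through \<open>D\<close>.\<close>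

definition network_gradient ::
  "('a::finite \<Rightarrow> real ^ 'n::finite \<Rightarrow> real) \<Rightarrow> ('k::finite \<Rightarrow> real) \<Rightarrow> real ^ 'k ^ 'a \<Rightarrow>
    (real ^ 'n) ^ 'a \<Rightarrow> (real ^ 'n) ^ 'a"
  where "network_gradient f \<beta> E p =
    (\<chi> i. gradient (f i) (p $ i)) + block_mult E (block_scale \<beta> (block_mult (transpose E) p))"

lemma trajectory_outputs:
  assumes "trajectory f \<alpha> \<beta> E x u y z \<zeta> d" "0 \<le> t"
  shows "y i t = x i t" "\<zeta> k t = block_mult (transpose E) (\<chi> i. x i t) $ k"
    "d k t = z k t + \<beta> k *\<^sub>R \<zeta> k t"
  using assms by (simp_all add: trajectory_def interconnected_iff agent_output_def
      controller_output_def)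

lemma trajectory_saddle_flow:
  fixes f :: "'a::finite \<Rightarrow> real ^ 'n::finite \<Rightarrow> real"
    and E :: "real ^ 'k::finite ^ 'a"
  assumes \<alpha>: "\<And>i. \<alpha> i > 0" and \<beta>: "\<And>k. \<beta> k > 0"
    and ker: "matrix_kernel (transpose E) = {c *\<^sub>R (1 :: real ^ 'a) | c. True}"
    and diff: "\<And>i p. f i differentiable (at p)"
    and conv: "\<And>i. convex_on UNIV (f i)"
    and strict: "strictly_convex (\<lambda>p. \<Sum>i\<in>UNIV. f i p)"
    and min: "\<And>p. (\<Sum>i\<in>UNIV. f i ystar) \<le> (\<Sum>i\<in>UNIV. f i p)"
    and traj: "trajectory f \<alpha> \<beta> E x u y z \<zeta> d"
  shows "saddle_flow (\<lambda>t. \<chi> i. x i t) (\<lambda>t. \<chi> k. z k t) (network_gradient f \<beta> E)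
    (block_mult E) (block_mult (transpose E))
    (block_scale \<alpha>) (block_scale (\<lambda>i. inverse (\<alpha> i))) (block_scale \<beta>)
    (block_scale (\<lambda>k. inverse (\<beta> k)))
    (\<chi> i. ystar)"
proof (rule saddle_flow.intro)
  interpret D: bounded_linear "block_mult E :: (real ^ 'n) ^ 'k \<Rightarrow> _"
      by (rule bounded_linear_block_mult)
  interpret D': bounded_linear "block_mult (transpose E) :: (real ^ 'n) ^ 'a \<Rightarrow> _"
      by (rule bounded_linear_block_mult)
  show D'a: "block_mult (transpose E) (\<chi> i. ystar) = 0"
    using block_mult_transpose_eq_0_iff[OF ker] by blast
  show "((\<lambda>t. \<chi> k. z k t) has_vector_derivative block_scale \<beta> (block_mult (transpose E)
      (\<chi> i. x i t))) (at t within {0..})"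
    if t: "0 \<le> t" for t
  proof -
    have "(\<chi> k. controller_field (\<beta> k) (\<zeta> k t)) = block_scale \<beta> (block_mult (transpose E)
        (\<chi> i. x i t))"
      using traj t by (simp add: trajectory_def interconnected_iff controller_field_def
          block_scale_def agent_output_def)
    moreover have "((\<lambda>t. \<chi> k. z k t) has_vector_derivative (\<chi> k. controller_field (\<beta> k) (\<zeta> k t)))
        (at t within {0..})"
      using traj t by (intro has_vector_derivative_vec_lambda) (simp add: trajectory_def)
    ultimately show ?thesis by simp
  qed
  show "((\<lambda>t. \<chi> i. x i t) has_vector_derivative block_scale \<alpha>
      (- network_gradient f \<beta> E (\<chi> i. x i t) - block_mult E (\<chi> k. z k t))) (at t within {0..})"
    if t: "0 \<le> t" for t
  proof -
    have "d k t = z k t + \<beta> k *\<^sub>R block_mult (transpose E) (\<chi> i. x i t) $ k" for k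
      using traj t by (simp add: trajectory_def interconnected_iff controller_output_def
          agent_output_def)
    then have "(\<chi> k. d k t) = (\<chi> k. z k t) + block_scale \<beta> (block_mult (transpose E) (\<chi> i. x i t))"
      unfolding vec_eq_iff[where 'b = 'k] by (simp add: block_scale_def)
    moreover have "u i t = - block_mult E (\<chi> k. d k t) $ i" for i
      using traj t by (simp add: trajectory_def interconnected_iff)
    \<comment> \<open>Inserting \<open>d\<close> splits the input into the action of the integrator
      states and the damping term of \<open>network_gradient\<close>.\<close>
    ultimately have u: "u i t = - (block_mult E (\<chi> k. z k t) $ i) -
        block_mult E (block_scale \<beta> (block_mult (transpose E) (\<chi> i. x i t))) $ i" for i
      by (simp add: D.add)
    have "(\<chi> i. agent_field (f i) (\<alpha> i) (x i t) (u i t))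
      = block_scale \<alpha> (- network_gradient f \<beta> E (\<chi> i. x i t) - block_mult E (\<chi> k. z k t))"
      unfolding vec_eq_iff[where 'b = 'a] by (simp add: agent_field_def network_gradient_def u
          algebra_simps)
    moreover have "((\<lambda>t. \<chi> i. x i t) has_vector_derivative (\<chi> i. agent_field (f i) (\<alpha> i) (x i t)
        (u i t))) (at t within {0..})"
      using traj t by (intro has_vector_derivative_vec_lambda) (simp add: trajectory_def)
    ultimately show ?thesis by simp
  qed
  show "continuous_on UNIV (network_gradient f \<beta> E)"
    unfolding network_gradient_def
    by (intro continuous_on_add continuous_on_vec_lambda
        continuous_on_compose2[OF continuous_on_gradient_convex[OF conv diff]]
        bounded_linear.continuous_on[OF bounded_linear_block_mult]
        bounded_linear.continuous_on[OF bounded_linear_block_scale]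
        continuous_intros) auto
  show "\<exists>c>0. \<forall>p :: (real ^ 'n) ^ 'a. c * (norm p)\<^sup>2 \<le> p \<bullet> block_scale (\<lambda>i. inverse (\<alpha> i)) p"
    using \<alpha> by (intro block_scale_coercive) simp
  show "\<exists>c>0. \<forall>p :: (real ^ 'n) ^ 'k. c * (norm p)\<^sup>2 \<le> p \<bullet> block_scale (\<lambda>i. inverse (\<beta> i)) p"
    using \<beta> by (intro block_scale_coercive) simp
  show "block_scale (\<lambda>i. inverse (\<alpha> i)) (block_scale \<alpha> p) = p" for p :: "(real ^ 'n) ^ 'a"
    using \<alpha> by (intro block_scale_inverse) (metis less_irrefl)
  show "block_scale (\<lambda>i. inverse (\<beta> i)) (block_scale \<beta> p) = p" for p :: "(real ^ 'n) ^ 'k"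
    using \<beta> by (intro block_scale_inverse) (metis less_irrefl)
  fix p :: "(real ^ 'n) ^ 'a" assume p: "p \<noteq> (\<chi> i. ystar)"
  define \<xi> where "\<xi> = block_mult (transpose E) p"
  define M where "M = (\<Sum>i\<in>UNIV. (p $ i - ystar) \<bullet> (gradient (f i) (p $ i) - gradient (f i) ystar))"
  \<comment> \<open>Adjointness turns the damping term into a weighted square of the disagreement
    \<open>\<xi>\<close>, since consensus vectors are annihilated.\<close>
  have "(p - (\<chi> i. ystar)) \<bullet> block_mult E (block_scale \<beta> \<xi>) = \<xi> \<bullet> block_scale \<beta> \<xi>"
    using block_mult_adjoint[of E "block_scale \<beta> \<xi>" "p - (\<chi> i. ystar)"] D'a
    by (simp add: \<xi>_def D'.diff inner_commute)
  moreover have "block_mult (transpose E) (\<chi> i. ystar) = 0" by (rule D'a)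
  ultimately have eq: "(p - (\<chi> i. ystar)) \<bullet> (network_gradient f \<beta> E p -
      network_gradient f \<beta> E (\<chi> i. ystar))
      = M + \<xi> \<bullet> block_scale \<beta> \<xi>"
    by (simp add: network_gradient_def \<xi>_def[symmetric] M_def inner_vec_def[of _ "vec_lambda _"]
        inner_vec_def[of _ "vec_lambda _ - vec_lambda _"]
        inner_add_right inner_diff_right sum.distrib sum_subtractf)
  have M: "0 \<le> M" unfolding M_def by (intro sum_nonneg gradient_monotone conv diff)
  obtain m where m: "0 < m" "m * (norm \<xi>)\<^sup>2 \<le> \<xi> \<bullet> block_scale \<beta> \<xi>"
    using block_scale_coercive[of \<beta>, OF \<beta>] by blast
  show "0 < (p - (\<chi> i. ystar)) \<bullet> (network_gradient f \<beta> E p - network_gradient f \<beta> E (\<chi> i. ystar))"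
  \<comment> \<open>Away from consensus the weighted square is positive. At consensus it vanishes,
    and strict convexity of the sum makes \<open>M\<close> positive.\<close>
  proof (cases "\<xi> = 0")
    case False
    then have "0 < m * (norm \<xi>)\<^sup>2" using m(1) by simp
    then show ?thesis using m M eq by linarith
  next
    case True
    then obtain q where q: "p = (\<chi> i. q)"
      using block_mult_transpose_eq_0_iff[OF ker] unfolding \<xi>_def by blast
    have "0 < (q - ystar) \<bullet> ((\<Sum>i\<in>UNIV. gradient (f i) q) - (\<Sum>i\<in>UNIV. gradient (f i) ystar))"
      using strictly_convex_sum_gradient_pos[OF conv diff strict min, of q] p q
      by (auto simp: sum_gradient_at_minimizer[OF diff min])
    then have "0 < M" by (simp add: M_def q inner_sum_right flip: sum_subtractf)
    then show ?thesis using eq True by simp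
  qed
qed (auto intro: bounded_linear_block_mult bounded_linear_block_scale block_mult_adjoint
    block_scale_symmetric)

text \<open>Positive gains make a vanishing field equivalent to a balanced input. With
  \<open>\<zeta>\<close> zero the feedthrough and the damping term disappear, which leaves the
  equilibrium equation of the saddle flow.\<close>

lemma equilibrium_iff:
  fixes f :: "'a::finite \<Rightarrow> real ^ 'n::finite \<Rightarrow> real" and E :: "real ^ 'k::finite ^ 'a"
  assumes \<alpha>: "\<And>i. \<alpha> i > 0" and \<beta>: "\<And>k. \<beta> k > 0"
  shows "equilibrium f \<alpha> \<beta> E x u y z \<zeta> d \<longleftrightarrow>
    y = x \<and> d = z \<and> (\<forall>k. \<zeta> k = 0) \<and> block_mult (transpose E) (vec_lambda x) = 0 \<and>
    (\<forall>i. u i = gradient (f i) (x i)) \<and> network_gradient f \<beta> E (vec_lambda x)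
        + block_mult E (vec_lambda z) = 0"
    (is "?L \<longleftrightarrow> ?R")
proof -
  have a: "agent_field (f i) (\<alpha> i) (x i) (u i) = 0 \<longleftrightarrow> u i = gradient (f i) (x i)" for i
  proof -
    have "agent_field (f i) (\<alpha> i) (x i) (u i) = \<alpha> i *\<^sub>R (u i - gradient (f i) (x i))"
      by (simp add: agent_field_def algebra_simps)
    then show ?thesis using \<alpha>[of i] by simp
  qed
  have c: "controller_field (\<beta> k) (\<zeta> k) = 0 \<longleftrightarrow> \<zeta> k = 0" for k
    using \<beta>[of k] by (simp add: controller_field_def)
  have G: "network_gradient f \<beta> E (vec_lambda x) = (\<chi> i. gradient (f i) (x i))"
    if "block_mult (transpose E) (vec_lambda x) = 0"
    using that by (simp add: network_gradient_def)
  show ?thesis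
  proof
    assume L: ?L
    then have yx: "y = x" and \<zeta>: "\<And>k. \<zeta> k = 0" and u: "\<And>i. u i = gradient (f i) (x i)"
      by (auto simp: equilibrium_def a c agent_output_def)
    have dz: "d = z" using L \<zeta> by (auto simp: equilibrium_def controller_output_def)
    have 0: "block_mult (transpose E) (vec_lambda x) = 0"
      using L yx \<zeta> unfolding equilibrium_def interconnected_iff vec_eq_iff[where 'b = 'k] by simp
    have "(\<chi> i. gradient (f i) (x i)) + block_mult E (vec_lambda z) = 0"
      using L u dz unfolding equilibrium_def interconnected_iff vec_eq_iff[where 'b = 'a] by simp
    then show ?R using yx dz \<zeta> u 0 by (simp add: G)
  next
    assume R: ?R
    then have 0: "block_mult (transpose E) (vec_lambda x) = 0" by blast
    have "(\<chi> i. gradient (f i) (x i)) + block_mult E (vec_lambda z) = 0"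
      using R unfolding G[OF 0] by blast
    then have g: "gradient (f i) (x i) = - block_mult E (vec_lambda z) $ i" for i
      unfolding vec_eq_iff[where 'b = 'a] by (simp add: eq_neg_iff_add_eq_0)
    show ?L unfolding equilibrium_def interconnected_iff a c
      using R 0 by (simp add: agent_output_def controller_output_def g)
  qed
qed

theorem theorem28:
  fixes f :: "'a::finite \<Rightarrow> real ^ 'n::finite \<Rightarrow> real"
    and \<alpha> :: "'a \<Rightarrow> real"
    and \<beta> :: "'k::finite \<Rightarrow> real"
    and E :: "real ^ 'k ^ 'a"
    and ystar :: "real ^ 'n"
  assumes "\<forall>i. \<alpha> i > 0"
    and "\<forall>k. \<beta> k > 0"
    and "matrix_kernel (transpose E) = {c *\<^sub>R (1 :: real ^ 'a) | c. True}"
    and "\<forall>i p. f i differentiable (at p)"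
    and "\<forall>i. convex_on UNIV (f i)"
    and "strictly_convex (\<lambda>p. \<Sum>i\<in>UNIV. f i p)"
    and "\<forall>p. (\<Sum>i\<in>UNIV. f i ystar) \<le> (\<Sum>i\<in>UNIV. f i p)"
  shows "(\<forall>x u y z \<zeta> d. trajectory f \<alpha> \<beta> E x u y z \<zeta> d \<longrightarrow>
            (\<exists>xbar ubar ybar zbar \<zeta>bar dbar.
               equilibrium f \<alpha> \<beta> E xbar ubar ybar zbar \<zeta>bar dbar \<and>
               (col ybar, col dbar) \<in> M_eq ystar \<and>
               (\<forall>i. (x i \<longlongrightarrow> xbar i) at_top) \<and>
               (\<forall>k. (z k \<longlongrightarrow> zbar k) at_top) \<and>
               ((\<lambda>t. (col (\<lambda>i. y i t), col (\<lambda>k. d k t))) \<longlongrightarrow> (col ybar, col dbar)) at_top)) \<and>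
         invariant_set f \<alpha> \<beta> E (M_eq ystar \<inter> equilibrium_outputs f \<alpha> \<beta> E)"
proof (intro conjI allI impI)
  have \<alpha>: "\<And>i. \<alpha> i > 0" and \<beta>: "\<And>k. \<beta> k > 0"
    and diff: "\<And>i p. f i differentiable (at p)" and conv: "\<And>i. convex_on UNIV (f i)"
    and min: "\<And>p. (\<Sum>i\<in>UNIV. f i ystar) \<le> (\<Sum>i\<in>UNIV. f i p)"
    using assms by auto
  note ker = assms(3) and strict = assms(6)
  have kernel: "block_mult (transpose E) (\<chi> i. ystar) = 0"
    using block_mult_transpose_eq_0_iff[OF ker] by blast
  {
    fix x u y z \<zeta> d assume traj: "trajectory f \<alpha> \<beta> E x u y z \<zeta> d"
    interpret saddle_flow "\<lambda>t. \<chi> i. x i t" "\<lambda>t. \<chi> k. z k t" "network_gradient f \<beta> E"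
      "block_mult E" "block_mult (transpose E)"
      "block_scale \<alpha>" "block_scale (\<lambda>i. inverse (\<alpha> i))" "block_scale \<beta>"
      "block_scale (\<lambda>k. inverse (\<beta> k))"
      "\<chi> i. ystar"
      by (rule trajectory_saddle_flow[OF \<alpha> \<beta> ker diff conv strict min traj])
    note out = trajectory_outputs[OF traj]
    \<comment> \<open>First-order optimality of \<open>ystar\<close> yields a controller state
      \<open>b\<close> that balances the individual gradients, hence an equilibrium to start
      from.\<close>
    have "(\<Sum>i\<in>UNIV. (- (\<chi> i. gradient (f i) ystar)) $ i) = 0"
      by (simp add: sum_negf sum_gradient_at_minimizer[OF diff min])
    then have "- (\<chi> i. gradient (f i) ystar) \<in> range (block_mult E)"
      by (rule sum_eq_0_imp_in_range_block_mult[OF ker])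
    then obtain b where "- (\<chi> i. gradient (f i) ystar) = block_mult E b" by blast
    moreover have "network_gradient f \<beta> E (\<chi> i. ystar) = (\<chi> i. gradient (f i) ystar)"
      using kernel by (simp add: network_gradient_def)
    ultimately have "network_gradient f \<beta> E (\<chi> i. ystar) + block_mult E b = 0"
      by (metis add.right_inverse)
    then obtain b' where b': "network_gradient f \<beta> E (\<chi> i. ystar) + block_mult E b' = 0"
      and X: "((\<lambda>t. \<chi> i. x i t) \<longlongrightarrow> (\<chi> i. ystar)) at_top"
      and Z: "((\<lambda>t. \<chi> k. z k t) \<longlongrightarrow> b') at_top"
      by (rule converges)
    have x: "(x i \<longlongrightarrow> ystar) at_top" for i
      using tendsto_vec_nth[OF X, of i] by simp
    have z: "(z k \<longlongrightarrow> b' $ k) at_top" for k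
      using tendsto_vec_nth[OF Z, of k] by simp
    have "((\<lambda>t. block_mult (transpose E) (\<chi> i. x i t)) \<longlongrightarrow> 0) at_top"
      using bounded_linear.tendsto[OF bounded_linear_block_mult X, of "transpose E"]
          by (simp add: kernel)
    note \<zeta> = tendsto_vec_nth[OF this]
    have "((\<lambda>t. z k t + \<beta> k *\<^sub>R block_mult (transpose E) (\<chi> i. x i t) $ k) \<longlongrightarrow> b' $ k
        + \<beta> k *\<^sub>R 0 $ k) at_top" for k
      by (rule tendsto_add[OF z tendsto_scaleR[OF tendsto_const \<zeta>]])
    \<comment> \<open>The output equations hold for nonnegative times only, so the limits are
      transferred by eventual equality.\<close>
    then have d: "(d k \<longlongrightarrow> b' $ k) at_top" for k
      by (rule Lim_transform_eventually[THEN tendsto_eq_rhs])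
        (auto intro: eventually_mono[OF eventually_ge_at_top[of 0]] simp: out)
    have y: "(y i \<longlongrightarrow> ystar) at_top" for i
      by (rule Lim_transform_eventually[OF x[of i]])
        (auto intro: eventually_mono[OF eventually_ge_at_top[of 0]] simp: out)
    have "equilibrium f \<alpha> \<beta> E (\<lambda>i. ystar) (\<lambda>i. gradient (f i) ystar) (\<lambda>i. ystar) (($) b') (\<lambda>k. 0)
        (($) b')"
      using b' kernel by (simp add: equilibrium_iff[OF \<alpha> \<beta>])
    moreover have "(col (\<lambda>i. ystar), col (($) b')) \<in> M_eq ystar"
      by (simp add: M_eq_def col_def kron_vec_def)
    moreover have "((\<lambda>t. (col (\<lambda>i. y i t), col (\<lambda>k. d k t))) \<longlongrightarrow> (col (\<lambda>i. ystar), col (($) b')))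
        at_top"
      unfolding col_def by (intro tendsto_Pair tendsto_vec_lambda tendsto_vec_nth y d)
    ultimately show "\<exists>xbar ubar ybar zbar \<zeta>bar dbar.
               equilibrium f \<alpha> \<beta> E xbar ubar ybar zbar \<zeta>bar dbar \<and>
               (col ybar, col dbar) \<in> M_eq ystar \<and>
               (\<forall>i. (x i \<longlongrightarrow> xbar i) at_top) \<and>
               (\<forall>k. (z k \<longlongrightarrow> zbar k) at_top) \<and>
               ((\<lambda>t. (col (\<lambda>i. y i t), col (\<lambda>k. d k t))) \<longlongrightarrow> (col ybar, col dbar)) at_top"
      using x z by blast
  }
  show "invariant_set f \<alpha> \<beta> E (M_eq ystar \<inter> equilibrium_outputs f \<alpha> \<beta> E)"
    unfolding invariant_set_def
  proof (intro allI impI)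
    fix x u y z \<zeta> d and t :: real
    assume traj: "trajectory f \<alpha> \<beta> E x u y z \<zeta> d" and t: "0 \<le> t"
      and init: "(col (\<lambda>i. y i 0), col (\<lambda>k. d k 0)) \<in> M_eq ystar \<inter> equilibrium_outputs f \<alpha> \<beta> E"
    interpret saddle_flow "\<lambda>t. \<chi> i. x i t" "\<lambda>t. \<chi> k. z k t" "network_gradient f \<beta> E"
      "block_mult E" "block_mult (transpose E)"
      "block_scale \<alpha>" "block_scale (\<lambda>i. inverse (\<alpha> i))" "block_scale \<beta>"
      "block_scale (\<lambda>k. inverse (\<beta> k))"
      "\<chi> i. ystar"
      by (rule trajectory_saddle_flow[OF \<alpha> \<beta> ker diff conv strict min traj])
    note out = trajectory_outputs[OF traj]
    have "col (\<lambda>i. y i 0) = col (\<lambda>i. ystar)"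
      using init by (simp add: M_eq_def col_def kron_vec_def)
    then have y0: "y i 0 = ystar" for i by (simp add: col_inject fun_eq_iff)
    then have x0: "x i 0 = ystar" for i using out(1)[of 0 i] by simp
    \<comment> \<open>At consensus \<open>\<zeta>\<close> vanishes, so the feedthrough does not
      separate \<open>d\<close> from \<open>z\<close>.\<close>
    have d0: "d k 0 = z k 0" for k using out(2,3)[of 0 k] kernel by (simp add: x0)
    \<comment> \<open>Membership in the set provides only some internal signals with these outputs;
      \<open>equilibrium_iff\<close> identifies them with the initial state of the
      trajectory.\<close>
    obtain xe ue ze \<zeta>e where "equilibrium f \<alpha> \<beta> E xe ue (\<lambda>i. y i 0) ze \<zeta>e (\<lambda>k. d k 0)"
      using init unfolding equilibrium_outputs_def by (auto simp: col_inject)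
    then have "xe = (\<lambda>i. ystar)" "ze = (\<lambda>k. z k 0)"
      "network_gradient f \<beta> E (vec_lambda xe) + block_mult E (vec_lambda ze) = 0"
      unfolding equilibrium_iff[OF \<alpha> \<beta>] by (auto simp: y0 d0)
    then have eq: "network_gradient f \<beta> E (\<chi> i. ystar) + block_mult E (\<chi> k. z k 0) = 0" by simp
    \<comment> \<open>The reference point \<open>b\<close> is the initial controller state
      itself.\<close>
    note stationary[OF eq _ _ t]
    then have "(\<chi> i. x i t) = (\<chi> i. ystar)" "(\<chi> k. z k t) = (\<chi> k. z k 0)"
      by (simp_all add: x0)
    then have "x i t = ystar" "z k t = z k 0" for i k
        by (simp_all add: vec_lambda_inject fun_eq_iff)
    then have "y i t = y i 0" "d k t = d k 0" for i k
      using out[OF t] kernel by (simp_all add: y0 d0)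
    then show "(col (\<lambda>i. y i t), col (\<lambda>k. d k t)) \<in> M_eq ystar \<inter> equilibrium_outputs f \<alpha> \<beta> E"
      using init by simp
  qed
qed

end
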